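(* For every positive rational number $t$ and every graph $G$, there exists a minimally $t$-tough graph $H$ that contains an induced subgraph isomorphic to $G$.
   Context: All graphs are finite, simple and undirected. For a graph $G$, $\omega(G)$ denotes the number of connected components of $G$. A cutset of $G$ is a set $S\subseteq V(G)$ such that $G-S$ is disconnected, i.e. $\omega(G-S)\ge 2$. For a positive real number $t$, a graph $G$ is called $t$-tough if $\omega(G-S)\le |S|/t$ for every cutset $S$ of $G$. The toughness $\tau(G)$ is the largest $t$ for which $G$ is $t$-tough, with $\tau(K_n)=\infty$ for all $n\ge 1$ (and $\tau(G)=0$ if $G$ is disconnected). A graph $G$ is minimally $t$-tough if $\tau(G)=t$ and $\tau(G-e)<t$ for every $e\in E(G)$. *)

theory Defs
  imports "Graph_Theory.Graph_Theory" "HOL-Library.Extended_Real"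
begin

text \<open>
  Finite simple undirected graphs are the digraphs satisfying the locale predicate
  \<^const>\<open>graph\<close>: finite, loop-free, without parallel arcs, and symmetric. An undirected
  edge is a pair of mutually opposite arcs, so deleting an edge removes both of them, and the
  connected components are the strongly connected ones.
\<close>

definition num_components :: "('a, 'b) pre_digraph \<Rightarrow> nat" where
  "num_components G = card (pre_digraph.sccs G)"

definition del_verts :: "('a, 'b) pre_digraph \<Rightarrow> 'a set \<Rightarrow> ('a, 'b) pre_digraph" where
  "del_verts G S = G \<restriction> (verts G - S)"

definition del_edge :: "('a, 'b) pre_digraph \<Rightarrow> 'b \<Rightarrow> ('a, 'b) pre_digraph" where
  "del_edge G e = G\<lparr>arcs := {a \<in> arcs G. {tail G a, head G a} \<noteq> {tail G e, head G e}}\<rparr>"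

definition cutset :: "('a, 'b) pre_digraph \<Rightarrow> 'a set \<Rightarrow> bool" where
  "cutset G S \<longleftrightarrow> S \<subseteq> verts G \<and> num_components (del_verts G S) \<ge> 2"

text \<open>Only meant for \<open>t > 0\<close>.\<close>

definition tough :: "real \<Rightarrow> ('a, 'b) pre_digraph \<Rightarrow> bool" where
  "tough t G \<longleftrightarrow>
     (\<forall>S. cutset G S \<longrightarrow> real (num_components (del_verts G S)) \<le> real (card S) / t)"

text \<open>
  The graph without vertices counts as complete here. In the last case the maximum exists,
  see \<open>toughness_greatest\<close> below.
\<close>

definition toughness :: "('a, 'b) pre_digraph \<Rightarrow> ereal" where
  "toughness G =
     (if \<exists>n. complete_digraph n G then \<infinity>
      else if num_components G \<ge> 2 then 0
      else ereal (GREATEST t. 0 < t \<and> tough t G))"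

definition minimally_tough :: "real \<Rightarrow> ('a, 'b) pre_digraph \<Rightarrow> bool" where
  "minimally_tough t G \<longleftrightarrow>
     toughness G = ereal t \<and> (\<forall>e \<in> arcs G. toughness (del_edge G e) < ereal t)"

lemma graph_del_edge:
  assumes "graph G"
  shows "graph (del_edge G e)"
proof -
  interpret graph G by fact
  show ?thesis
  proof (unfold_locales, goal_cases)
    case (6 a b)
    then show ?case using no_multi_arcs by (auto simp: del_edge_def arc_to_ends_def)
  next
    case 7
    show ?case unfolding symmetric_def
    proof (rule symI)
      fix u v assume "(u, v) \<in> arcs_ends (del_edge G e)"
      then obtain a where a: "a \<in> arcs G" "tail G a = u" "head G a = v"
          "{u, v} \<noteq> {tail G e, head G e}"
        by (auto simp: del_edge_def arcs_ends_def arc_to_ends_def)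
      then have "(u, v) \<in> arcs_ends G" by (auto simp: arcs_ends_def arc_to_ends_def)
      then have "(v, u) \<in> arcs_ends G" by (rule graph_symmetric)
      then obtain b where "b \<in> arcs G" "tail G b = v" "head G b = u"
        by (auto simp: arcs_ends_def arc_to_ends_def)
      with a(4) show "(v, u) \<in> arcs_ends (del_edge G e)"
        by (force simp: del_edge_def arcs_ends_def arc_to_ends_def insert_commute)
    qed
  qed (use no_loops in \<open>auto simp: del_edge_def\<close>)
qed

lemma ex_cutset:
  assumes "graph G" "\<nexists>n. complete_digraph n G"
  shows "\<exists>S. cutset G S"
proof -
  interpret graph G by fact
  have "arcs_ends G \<noteq> {(u,v). (u,v) \<in> verts G \<times> verts G \<and> u \<noteq> v}"
    using assms by (auto simp: complete_digraph_def)
  moreover have "arcs_ends G \<subseteq> {(u,v). (u,v) \<in> verts G \<times> verts G \<and> u \<noteq> v}"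
    using no_loops by (auto simp: arcs_ends_def arc_to_ends_def)
  ultimately obtain u v where uv: "u \<in> verts G" "v \<in> verts G" "u \<noteq> v" "(u, v) \<notin> arcs_ends G"
    by auto
  then have vu: "(v, u) \<notin> arcs_ends G" using graph_symmetric by blast
  define S where "S = verts G - {u, v}"
  define H where "H = del_verts G S"
  have H: "H = G \<restriction> {u, v}"
    using uv by (simp add: H_def del_verts_def S_def Diff_Diff_Int Int_absorb1)
  interpret H: wf_digraph H unfolding H by (rule wellformed_induce_subgraph)
  have vH: "verts H = {u, v}" by (simp add: H)
  have aH: "arcs_ends H = {}"
    using uv vu no_loops by (auto simp: H arcs_ends_def arc_to_ends_def)
  have reach: "x \<rightarrow>\<^sup>*\<^bsub>H\<^esub> y \<longleftrightarrow> x = y \<and> x \<in> {u, v}" for x y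
  proof
    assume "x \<rightarrow>\<^sup>*\<^bsub>H\<^esub> y"
    then show "x = y \<and> x \<in> {u, v}"
      unfolding reachable_def vH aH by (induction rule: rtrancl_on.induct) auto
  qed (auto simp: vH)
  have "{{u}, {v}} \<subseteq> H.sccs_verts"
    unfolding H.sccs_verts_def reach by auto
  moreover have "finite H.sccs_verts"
  proof (rule finite_subset)
    show "H.sccs_verts \<subseteq> Pow {u, v}" unfolding H.sccs_verts_def reach by auto
  qed simp
  ultimately have "card {{u}, {v}} \<le> card H.sccs_verts" by (intro card_mono)
  then have "num_components H \<ge> 2"
    using uv by (simp add: num_components_def H.card_sccs_verts)
  then have "cutset G S" by (auto simp: cutset_def H_def S_def)
  then show ?thesis ..
qed

text \<open>The maximum in the definition of toughness is attained.\<close>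

lemma toughness_greatest:
  assumes "graph G" "\<nexists>n. complete_digraph n G" "num_components G < 2"
  shows "\<exists>t. toughness G = ereal t \<and> 0 < t \<and> tough t G \<and> (\<forall>s > 0. tough s G \<longrightarrow> s \<le> t)"
proof -
  interpret graph G by fact
  define q where "q S = real (card S) / real (num_components (del_verts G S))" for S
  define C where "C = Collect (cutset G)"
  have "C \<subseteq> Pow (verts G)" by (auto simp: C_def cutset_def)
  then have fin: "finite (q ` C)" by (meson finite_Pow_iff finite_imageI finite_subset finite_verts)
  have ne: "q ` C \<noteq> {}" using ex_cutset[OF assms(1,2)] by (auto simp: C_def)
  have del0: "del_verts G {} = G"
    using wellformed by (intro pre_digraph.equality) (auto simp: del_verts_def)
  have pos: "0 < q S" if "S \<in> C" for S
  proof -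
    from that have "S \<noteq> {}" using assms(3) del0 by (auto simp: C_def cutset_def)
    moreover from that have "finite S"
      by (auto simp: C_def cutset_def intro: finite_subset)
    ultimately show ?thesis using that by (auto simp: q_def C_def cutset_def card_gt_0_iff)
  qed
  have tough_iff: "tough t G \<longleftrightarrow> (\<forall>S\<in>C. t \<le> q S)" if "0 < t" for t
  proof -
    have "real (num_components (del_verts G S)) \<le> real (card S) / t \<longleftrightarrow> t \<le> q S"
      if "S \<in> C" for S
    proof -
      have "0 < num_components (del_verts G S)" using that by (auto simp: C_def cutset_def)
      then show ?thesis using \<open>0 < t\<close> by (simp add: q_def field_simps)
    qed
    then show ?thesis by (auto simp: tough_def C_def)
  qed
  define m where "m = Min (q ` C)"
  have m: "0 < m" using fin ne pos by (simp add: m_def)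
  then have "tough m G" using fin by (simp add: tough_iff m_def)
  moreover have max: "s \<le> m" if "0 < s" "tough s G" for s
    using that fin ne by (simp add: tough_iff m_def)
  ultimately have "(GREATEST t. 0 < t \<and> tough t G) = m"
    using m by (intro Greatest_equality) auto
  then have "toughness G = ereal m" using assms by (auto simp: toughness_def)
  then show ?thesis using m \<open>tough m G\<close> max by blast
qed

end

theory Submission
  imports Defs
begin

text \<open>
  Deleting edges never increases toughness. Hence it suffices to find a graph \<open>H\<close> that contains \<open>G\<close>
  as an induced subgraph, has toughness exactly \<open>t\<close>, and stops being \<open>t\<close>-tough as soon as any edge
  of \<open>G\<close> is deleted: a spanning subgraph of \<open>H\<close> that is \<open>t\<close>-tough and has as few edges as possible
  is then minimally \<open>t\<close>-tough, and it still has all edges of \<open>G\<close>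
  (\<open>ex_minimal_tough_spanning\<close>, \<open>minimally_tough_rel_graph\<close>).

  Such an \<open>H\<close> comes from independence numbers. First enlarge \<open>G\<close>, on \<open>n\<close> vertices, to a graph \<open>N\<close>
  with independence number \<open>n\<close> in which every edge \<open>uv\<close> of \<open>G\<close> is critical: for each edge \<open>uv\<close> add
  \<open>n - 1\<close> independent new vertices, joined to all vertices of \<open>G\<close> but \<open>u\<close> and \<open>v\<close> and to all new
  vertices of the other edges. The new vertices of \<open>uv\<close> together with \<open>u\<close> and \<open>v\<close> form a set of
  size \<open>n + 1\<close> that spans the single edge \<open>uv\<close>.

  Next turn independence into toughness (locale \<open>tough_host\<close>). Attach \<open>m = \<lceil>1 / t\<rceil>\<close> leaves to
  every vertex of \<open>N\<close>, add \<open>k\<close> isolated vertices, and join everything to a clique of \<open>q\<close> hubs. Every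
  cutset contains all hubs. Consider \<open>t\<close> times the number of components minus the size of the cutset.
  Cutting a vertex of \<open>N\<close> contributes its leaves, \<open>t * m - 1\<close> in total, whereas keeping it
  contributes at most \<open>t\<close>, and this only once for each component of what is kept. As
  \<open>0 \<le> t * m - 1 < t\<close>, it is best to keep a maximum independent set of \<open>N\<close>. If \<open>q\<close> is exactly the
  gain of that choice then the toughness is \<open>t\<close>, and any edge deletion that raises the independence
  number of \<open>N\<close> destroys \<open>t\<close>-toughness. The isolated vertices serve to make this gain a
  natural number, which is possible because \<open>t\<close> is rational.

  Components are counted through colourings that are constant along edges: the number of components is
  the largest number of colours of such a colouring. This replaces all reasoning about paths.
\<close>

section \<open>Toughness through component colourings\<close>

definition simple_rel :: "'v set \<Rightarrow> ('v \<times> 'v) set \<Rightarrow> bool" where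
  "simple_rel V E \<longleftrightarrow> finite V \<and> E \<subseteq> V \<times> V \<and> sym E \<and> irrefl E"

text \<open>
  All constructions take place on plain relations, where vertices can be deleted or renamed without
  carrying arcs along.
\<close>

definition rel_graph :: "'v set \<Rightarrow> ('v \<times> 'v) set \<Rightarrow> ('v, 'v \<times> 'v) pre_digraph" where
  "rel_graph V E = \<lparr>verts = V, arcs = E, tail = fst, head = snd\<rparr>"

lemma rel_graph_simps [simp]:
  "verts (rel_graph V E) = V" "arcs (rel_graph V E) = E"
  "tail (rel_graph V E) = fst" "head (rel_graph V E) = snd"
  "arcs_ends (rel_graph V E) = E"
  by (simp_all add: rel_graph_def arcs_ends_def arc_to_ends_def)

lemma graph_rel_graph:
  assumes "simple_rel V E"
  shows "graph (rel_graph V E)"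
proof -
  have "finite V" "E \<subseteq> V \<times> V" "sym E" "irrefl E"
    using assms by (auto simp: simple_rel_def)
  moreover from this have "finite E" by (meson finite_SigmaI finite_subset)
  ultimately show ?thesis
    by unfold_locales (auto simp: symmetric_def arc_to_ends_def irrefl_def)
qed

lemma simple_rel_restrict:
  assumes "simple_rel V E"
  shows "simple_rel (V - S) (E \<inter> (V - S) \<times> (V - S))"
  using assms by (auto simp: simple_rel_def sym_def irrefl_def)

lemma simple_rel_del_edge:
  assumes "simple_rel V E"
  shows "simple_rel V (E - {(u, v), (v, u)})"
  using assms by (auto simp: simple_rel_def sym_def irrefl_def)

lemma del_verts_rel_graph:
  "del_verts (rel_graph V E) S = rel_graph (V - S) (E \<inter> (V - S) \<times> (V - S))"
  by (intro pre_digraph.equality) (auto simp: del_verts_def)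

lemma del_edge_rel_graph:
  "del_edge (rel_graph V E) (u, v) = rel_graph V (E - {(u, v), (v, u)})"
  by (intro pre_digraph.equality) (auto simp: del_edge_def rel_graph_def doubleton_eq_iff)

text \<open>
  Together with the next lemma: the number of components is the largest number of colours
  of a vertex colouring that is constant along edges.
\<close>

lemma card_colours_le_num_components:
  assumes "simple_rel V E" and c: "\<And>x y. (x, y) \<in> E \<Longrightarrow> c x = c y"
  shows "card (c ` V) \<le> num_components (rel_graph V E)"
proof -
  let ?G = "rel_graph V E"
  interpret graph ?G using assms(1) by (rule graph_rel_graph)
  have const: "c x = c y" if "x \<rightarrow>\<^sup>*\<^bsub>?G\<^esub> y" for x y
    using that unfolding reachable_def by (induction rule: rtrancl_on.induct) (auto dest: c)
  have "c u = (\<lambda>X. c (SOME x. x \<in> X)) (scc_of u)" if "u \<in> V" for u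
  proof -
    have "u \<in> scc_of u" using that in_scc_of_self by simp
    then have "(SOME x. x \<in> scc_of u) \<in> scc_of u" by (rule someI)
    then show ?thesis using const by (auto simp: scc_of_def)
  qed
  then have "c ` V \<subseteq> (\<lambda>X. c (SOME x. x \<in> X)) ` scc_of ` V" by blast
  moreover have "finite V" using assms by (simp add: simple_rel_def)
  ultimately have "card (c ` V) \<le> card (scc_of ` V)" by (intro surj_card_le) auto
  then show ?thesis
    by (simp add: num_components_def card_sccs_verts[symmetric] sccs_verts_conv_scc_of)
qed

lemma ex_colouring_num_components:
  assumes "simple_rel V E"
  shows "\<exists>c :: 'v \<Rightarrow> 'v set. (\<forall>(x, y)\<in>E. c x = c y) \<and>
           card (c ` (V :: 'v set)) = num_components (rel_graph V E)"
proof -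
  let ?G = "rel_graph V E"
  interpret graph ?G using assms by (rule graph_rel_graph)
  have "scc_of x = scc_of y" if "(x, y) \<in> E" for x y
    using that by (intro scc_of_eq scc_ofI_reachable) auto
  then show ?thesis
    by (intro exI[of _ scc_of])
      (auto simp: num_components_def card_sccs_verts[symmetric] sccs_verts_conv_scc_of)
qed

text \<open>
  The edges that meet \<open>S\<close> do not constrain the colouring, so it describes the graph with \<open>S\<close> deleted.
\<close>

definition component_colouring :: "('v \<times> 'v) set \<Rightarrow> 'v set \<Rightarrow> ('v \<Rightarrow> 'c) \<Rightarrow> bool" where
  "component_colouring E S c \<longleftrightarrow> (\<forall>x y. (x, y) \<in> E \<longrightarrow> x \<notin> S \<longrightarrow> y \<notin> S \<longrightarrow> c x = c y)"

definition tough_on :: "real \<Rightarrow> 'v set \<Rightarrow> ('v \<times> 'v) set \<Rightarrow> bool" where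
  "tough_on t V E \<longleftrightarrow> (\<forall>S (c :: 'v \<Rightarrow> nat).
     S \<subseteq> V \<longrightarrow> component_colouring E S c \<longrightarrow> 2 \<le> card (c ` (V - S)) \<longrightarrow>
     t * card (c ` (V - S)) \<le> card S)"

text \<open>
  Any type of colours will do, since a finite set of colours can be renamed into the natural numbers.
\<close>

lemma tough_onD:
  fixes c :: "'v \<Rightarrow> 'c"
  assumes "tough_on t V E" "finite V" "S \<subseteq> V" "component_colouring E S c"
    "2 \<le> card (c ` (V - S))"
  shows "t * card (c ` (V - S)) \<le> card S"
proof -
  have "finite (c ` (V - S))" using assms(2) by auto
  then obtain g :: "'c \<Rightarrow> nat" where g: "inj_on g (c ` (V - S))"
    by (meson finite_imp_inj_to_nat_seg)
  have "card ((g \<circ> c) ` (V - S)) = card (c ` (V - S))"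
    unfolding image_comp[symmetric] using g by (rule card_image)
  moreover have "component_colouring E S (g \<circ> c)"
    using assms(4) by (auto simp: component_colouring_def)
  ultimately show ?thesis using assms(1,3,5) unfolding tough_on_def by metis
qed

lemma tough_on_mono:
  assumes "tough_on t V E" "E \<subseteq> F"
  shows "tough_on t V F"
  using assms unfolding tough_on_def component_colouring_def by blast

lemma tough_rel_graph:
  assumes VE: "simple_rel V E" and "0 < t"
  shows "tough t (rel_graph V E) \<longleftrightarrow> tough_on t V E"
proof
  assume tough: "tough t (rel_graph V E)"
  show "tough_on t V E" unfolding tough_on_def
  proof (intro allI impI)
    fix S and c :: "'a \<Rightarrow> nat"
    assume S: "S \<subseteq> V" "component_colouring E S c" "2 \<le> card (c ` (V - S))"
    have le: "card (c ` (V - S)) \<le> num_components (del_verts (rel_graph V E) S)"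
      unfolding del_verts_rel_graph
      using S(2) by (intro card_colours_le_num_components simple_rel_restrict VE)
        (auto simp: component_colouring_def)
    then have "cutset (rel_graph V E) S" using S by (simp add: cutset_def)
    then have "num_components (del_verts (rel_graph V E) S) \<le> card S / t"
      using tough by (simp add: tough_def)
    with le have "card (c ` (V - S)) \<le> card S / t" by linarith
    then show "t * card (c ` (V - S)) \<le> card S" using \<open>0 < t\<close> by (simp add: field_simps)
  qed
next
  assume tough: "tough_on t V E"
  show "tough t (rel_graph V E)" unfolding tough_def
  proof (intro allI impI)
    fix S assume cut: "cutset (rel_graph V E) S"
    obtain c :: "'a \<Rightarrow> 'a set"
      where c: "\<forall>(x, y)\<in>E \<inter> (V - S) \<times> (V - S). c x = c y"
        and card: "card (c ` (V - S)) = num_components (del_verts (rel_graph V E) S)"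
      using ex_colouring_num_components[OF simple_rel_restrict[OF VE]]
      unfolding del_verts_rel_graph by blast
    have "component_colouring E S c"
      using c VE by (auto simp: component_colouring_def simple_rel_def)
    then have "t * card (c ` (V - S)) \<le> card S"
      using cut VE card tough by (intro tough_onD) (auto simp: cutset_def simple_rel_def)
    then show "num_components (del_verts (rel_graph V E) S) \<le> card S / t"
      using card \<open>0 < t\<close> by (simp add: field_simps)
  qed
qed

text \<open>
  Comparison with a fixed \<open>t\<close> avoids the maximum and the special value for disconnected graphs in
  the definition of toughness: a disconnected graph has the empty cutset and is not tough for any
  positive number.
\<close>

lemma toughness_less_iff:
  assumes G: "graph G" "\<nexists>n. complete_digraph n G" and "0 < t"
  shows "toughness G < ereal t \<longleftrightarrow> \<not> tough t G"
proof -
  have anti: "tough s G" if "tough r G" "0 < s" "s \<le> r" for r s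
  proof -
    have "real (card S) / r \<le> real (card S) / s" for S :: "'a set"
      using that by (simp add: frac_le)
    then show ?thesis using that(1) unfolding tough_def by (meson order_trans)
  qed
  show ?thesis
  proof (cases "num_components G < 2")
    case True
    then show ?thesis
      using toughness_greatest[OF G True] anti \<open>0 < t\<close> by (metis ereal_less(2) less_ereal.simps(1) linorder_not_le)
  next
    case False
    interpret graph G by fact
    have "del_verts G {} = G"
      using wellformed by (intro pre_digraph.equality) (auto simp: del_verts_def)
    then have "\<not> tough t G" using False by (auto simp: tough_def cutset_def)
    then show ?thesis using False G \<open>0 < t\<close> by (auto simp: toughness_def)
  qed
qed

text \<open>
  The colouring \<open>c\<close> and its cutset \<open>S\<close> show that the toughness is at most \<open>t\<close>. Its two colours
  also yield two nonadjacent vertices, so neither the graph nor any graph with fewer edges is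
  complete.
\<close>

lemma minimally_tough_rel_graph:
  fixes c :: "'v \<Rightarrow> 'c"
  assumes VE: "simple_rel V E" and t: "0 < t" and tough: "tough_on t V E"
    and crit: "\<And>u v. (u, v) \<in> E \<Longrightarrow> \<not> tough_on t V (E - {(u, v), (v, u)})"
    and S: "S \<subseteq> V" "component_colouring E S c" "2 \<le> card (c ` (V - S))"
      "t * card (c ` (V - S)) = card S"
  shows "minimally_tough t (rel_graph V E)"
proof -
  have "\<not> card (c ` (V - S)) \<le> Suc 0" using S(3) by simp
  moreover have "finite V" using VE by (simp add: simple_rel_def)
  ultimately obtain x y where xy: "x \<in> V - S" "y \<in> V - S" "c x \<noteq> c y"
    by (auto simp: card_le_Suc0_iff_eq)
  then have nonadj: "(x, y) \<notin> E" "x \<noteq> y" using S(2) by (auto simp: component_colouring_def)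
  have nc: "\<nexists>n. complete_digraph n (rel_graph V E')" if "E' \<subseteq> E" for E'
    using xy nonadj that by (auto simp: complete_digraph_def)
  have less_iff: "toughness (rel_graph V E') < ereal r \<longleftrightarrow> \<not> tough_on r V E'"
    if "E' \<subseteq> E" "simple_rel V E'" "0 < r" for E' r
    using that by (simp add: toughness_less_iff graph_rel_graph nc tough_rel_graph)
  have "\<not> tough_on r V E" if "t < r" for r
  proof
    assume "tough_on r V E"
    then have "r * card (c ` (V - S)) \<le> t * card (c ` (V - S))"
      using tough_onD[OF _ \<open>finite V\<close> S(1,2,3)] S(4) by simp
    then show False using that S(3) by (simp add: mult_le_cancel_right)
  qed
  then have "toughness (rel_graph V E) < ereal r" if "t < r" for r
    using less_iff VE that t by simp
  moreover have "\<not> toughness (rel_graph V E) < ereal t" using less_iff VE t tough by simp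
  ultimately have "toughness (rel_graph V E) = ereal t"
    by (metis ereal_dense2 less_ereal.simps(1) linorder_less_linear order_less_imp_not_less)
  moreover have "toughness (del_edge (rel_graph V E) e) < ereal t" if "e \<in> E" for e
    using that less_iff[OF _ simple_rel_del_edge[OF VE] t] crit
    by (cases e) (auto simp: del_edge_rel_graph)
  ultimately show ?thesis by (simp add: minimally_tough_def)
qed

section \<open>Minimal spanning subgraphs\<close>

text \<open>
  Take a \<open>t\<close>-tough spanning subgraph with the fewest edges. If it lacked an edge from \<open>F\<close>, it would
  be a subgraph of the given graph without that edge, which is not \<open>t\<close>-tough.
\<close>

lemma ex_minimal_tough_spanning:
  assumes VE: "simple_rel V E" and tough: "tough_on t V E"
    and crit: "\<And>u v. (u, v) \<in> F \<Longrightarrow> \<not> tough_on t V (E - {(u, v), (v, u)})"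
  obtains M where "M \<subseteq> E" "simple_rel V M" "tough_on t V M" "F \<inter> E \<subseteq> M"
    "\<And>u v. (u, v) \<in> M \<Longrightarrow> \<not> tough_on t V (M - {(u, v), (v, u)})"
proof -
  let ?P = "\<lambda>M. M \<subseteq> E \<and> simple_rel V M \<and> tough_on t V M"
  have "?P E" using VE tough by simp
  then obtain M where M: "?P M" and least: "\<And>M'. ?P M' \<Longrightarrow> card M \<le> card M'"
    using ex_has_least_nat[of ?P E card] by blast
  have "finite V" "E \<subseteq> V \<times> V" using VE by (auto simp: simple_rel_def)
  then have "finite M" using M by (meson finite_SigmaI finite_subset)
  have "\<not> tough_on t V (M - {(u, v), (v, u)})" if "(u, v) \<in> M" for u v
  proof
    assume "tough_on t V (M - {(u, v), (v, u)})"
    then have "card M \<le> card (M - {(u, v), (v, u)})"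
      using M by (intro least conjI simple_rel_del_edge) auto
    moreover have "card (M - {(u, v), (v, u)}) < card M"
      using that \<open>finite M\<close> by (intro psubset_card_mono) auto
    ultimately show False by simp
  qed
  moreover have "F \<inter> E \<subseteq> M"
  proof (rule subrelI, rule ccontr)
    fix u v assume uv: "(u, v) \<in> F \<inter> E" "(u, v) \<notin> M"
    then have "(v, u) \<notin> M" using M by (auto simp: simple_rel_def sym_def)
    then have "M \<subseteq> E - {(u, v), (v, u)}" using M uv by auto
    then show False using tough_on_mono crit M uv by blast
  qed
  ultimately show thesis using that M by blast
qed

lemma simple_rel_image:
  assumes "simple_rel V E" "inj_on f V"
  shows "simple_rel (f ` V) (map_prod f f ` E)"
  using assms by (fastforce simp: simple_rel_def sym_def irrefl_def inj_on_def)

lemma map_prod_image_iff: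
  assumes "inj_on f V" "E \<subseteq> V \<times> V" "x \<in> V" "y \<in> V"
  shows "(f x, f y) \<in> map_prod f f ` E \<longleftrightarrow> (x, y) \<in> E"
proof
  assume "(f x, f y) \<in> map_prod f f ` E"
  then obtain u v where uv: "(u, v) \<in> E" "f x = f u" "f y = f v" by auto
  then have "u \<in> V" "v \<in> V" using assms(2) by auto
  then have "x = u" "y = v" using assms uv(2,3) by (simp_all add: inj_on_eq_iff)
  then show "(x, y) \<in> E" using uv(1) by simp
qed (metis map_prod_imageI)

text \<open>
  The next three lemmas move a graph along an injective renaming of its vertices. They are what
  allows the construction to use a structured vertex type although the final graph lives on the
  natural numbers.
\<close>

lemma transport_colouring:
  assumes inj: "inj_on f V" and E: "E \<subseteq> V \<times> V" and S: "S \<subseteq> V" "component_colouring E S c"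
  shows "component_colouring (map_prod f f ` E) (f ` S) (c \<circ> the_inv_into V f)"
    and "(c \<circ> the_inv_into V f) ` (f ` V - f ` S) = c ` (V - S)"
    and "card (f ` S) = card S"
proof -
  have "c (the_inv_into V f (f x)) = c (the_inv_into V f (f y))"
    if "(x, y) \<in> E" "f x \<notin> f ` S" "f y \<notin> f ` S" for x y
  proof -
    have "x \<in> V" "y \<in> V" "x \<notin> S" "y \<notin> S" using that E by auto
    then show ?thesis
      using that(1) S(2) inj by (simp add: the_inv_into_f_f component_colouring_def)
  qed
  then show "component_colouring (map_prod f f ` E) (f ` S) (c \<circ> the_inv_into V f)"
    unfolding component_colouring_def by auto
  have "f ` V - f ` S = f ` (V - S)" using inj S(1) by (simp add: inj_on_image_set_diff)
  then show "(c \<circ> the_inv_into V f) ` (f ` V - f ` S) = c ` (V - S)"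
    unfolding image_image using inj by (auto simp: the_inv_into_f_f image_image)
  show "card (f ` S) = card S" using inj S(1) by (meson card_image inj_on_subset)
qed

lemma tough_on_image_iff:
  assumes inj: "inj_on f V" and E: "E \<subseteq> V \<times> V"
  shows "tough_on t (f ` V) (map_prod f f ` E) \<longleftrightarrow> tough_on t V E"
proof
  assume L: "tough_on t (f ` V) (map_prod f f ` E)"
  show "tough_on t V E" unfolding tough_on_def
  proof (intro allI impI)
    fix S and c :: "'a \<Rightarrow> nat"
    assume S: "S \<subseteq> V" "component_colouring E S c" "2 \<le> card (c ` (V - S))"
    note tr = transport_colouring[OF inj E S(1,2)]
    show "t * card (c ` (V - S)) \<le> card S"
      using L S(1,3) tr unfolding tough_on_def by (metis image_mono)
  qed
next
  assume R: "tough_on t V E"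
  show "tough_on t (f ` V) (map_prod f f ` E)" unfolding tough_on_def
  proof (intro allI impI)
    fix S and c :: "'b \<Rightarrow> nat"
    assume S: "S \<subseteq> f ` V" "component_colouring (map_prod f f ` E) S c"
      "2 \<le> card (c ` (f ` V - S))"
    let ?S = "{v \<in> V. f v \<in> S}"
    have "(c \<circ> f) ` (V - ?S) = c ` (f ` V - S)" by (auto simp: image_iff)
    moreover have "component_colouring E ?S (c \<circ> f)"
      using S E by (force simp: component_colouring_def)
    moreover have "card ?S = card S"
    proof -
      have "f ` ?S = S" using S(1) by auto
      moreover have "inj_on f ?S" using inj by (rule inj_on_subset) auto
      ultimately show ?thesis by (metis card_image)
    qed
    moreover have "?S \<subseteq> V" by auto
    ultimately show "t * card (c ` (f ` V - S)) \<le> card S"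
      using R S(3) unfolding tough_on_def by metis
  qed
qed

lemma minimally_tough_image:
  fixes c :: "'v \<Rightarrow> 'c"
  assumes inj: "inj_on f V" and VE: "simple_rel V E" and t: "0 < t" and tough: "tough_on t V E"
    and crit: "\<And>x y. (x, y) \<in> E \<Longrightarrow> \<not> tough_on t V (E - {(x, y), (y, x)})"
    and S: "S \<subseteq> V" "component_colouring E S c" "2 \<le> card (c ` (V - S))"
      "t * card (c ` (V - S)) = card S"
  shows "minimally_tough t (rel_graph (f ` V) (map_prod f f ` E))"
proof -
  have E: "E \<subseteq> V \<times> V" using VE by (simp add: simple_rel_def)
  note tr = transport_colouring[OF inj E S(1,2)]
  show ?thesis
  proof (rule minimally_tough_rel_graph)
    show "simple_rel (f ` V) (map_prod f f ` E)" using VE inj by (rule simple_rel_image)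
    show "tough_on t (f ` V) (map_prod f f ` E)" using tough inj E by (simp add: tough_on_image_iff)
  next
    fix a b assume "(a, b) \<in> map_prod f f ` E"
    then obtain x y where xy: "(x, y) \<in> E" "a = f x" "b = f y" by auto
    have "(y, x) \<in> E" using VE xy by (auto simp: simple_rel_def sym_def)
    have "inj_on (map_prod f f) E" using map_prod_inj_on[OF inj inj] E by (rule inj_on_subset)
    then have "map_prod f f ` (E - {(x, y), (y, x)})
        = map_prod f f ` E - map_prod f f ` {(x, y), (y, x)}"
      using xy(1) \<open>(y, x) \<in> E\<close> by (intro inj_on_image_set_diff) auto
    moreover have "\<not> tough_on t (f ` V) (map_prod f f ` (E - {(x, y), (y, x)}))"
      using crit[OF xy(1)] E by (subst tough_on_image_iff[OF inj]) auto
    ultimately show "\<not> tough_on t (f ` V) (map_prod f f ` E - {(a, b), (b, a)})"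
      using xy by simp
  next
    show "f ` S \<subseteq> f ` V" using S(1) by blast
    show "component_colouring (map_prod f f ` E) (f ` S) (c \<circ> the_inv_into V f)"
      by (rule tr(1))
    show "2 \<le> card ((c \<circ> the_inv_into V f) ` (f ` V - f ` S))" unfolding tr(2) by (rule S(3))
    show "t * card ((c \<circ> the_inv_into V f) ` (f ` V - f ` S)) = card (f ` S)"
      unfolding tr(2,3) by (rule S(4))
  qed (rule t)
qed

section \<open>Independence-critical extensions\<close>

text \<open>
  The vertices \<open>Inl v\<close> are those of the given graph. The vertices \<open>Inr (e, i)\<close> form the block of new
  vertices that belongs to the edge with end set \<open>e\<close>.
\<close>

fun ext_adj :: "('a \<times> 'a) set \<Rightarrow> 'a + 'a set \<times> nat \<Rightarrow> 'a + 'a set \<times> nat \<Rightarrow> bool" where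
  "ext_adj E (Inl u) (Inl v) \<longleftrightarrow> (u, v) \<in> E"
| "ext_adj E (Inl u) (Inr (e, i)) \<longleftrightarrow> u \<notin> e"
| "ext_adj E (Inr (e, i)) (Inl u) \<longleftrightarrow> u \<notin> e"
| "ext_adj E (Inr (e, i)) (Inr (f, j)) \<longleftrightarrow> e \<noteq> f"

definition ext_verts :: "'a set \<Rightarrow> ('a \<times> 'a) set \<Rightarrow> ('a + 'a set \<times> nat) set" where
  "ext_verts V E = Inl ` V \<union> Inr ` ((\<lambda>(u, v). {u, v}) ` E \<times> {..<card V - 1})"

definition ext_edges ::
    "'a set \<Rightarrow> ('a \<times> 'a) set \<Rightarrow> (('a + 'a set \<times> nat) \<times> ('a + 'a set \<times> nat)) set" where
  "ext_edges V E = {(x, y) \<in> ext_verts V E \<times> ext_verts V E. ext_adj E x y}"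

lemma simple_rel_ext:
  assumes "simple_rel V E"
  shows "simple_rel (ext_verts V E) (ext_edges V E)"
proof -
  have E: "finite V" "E \<subseteq> V \<times> V" "sym E" "irrefl E" using assms by (auto simp: simple_rel_def)
  then have "finite E" by (meson finite_SigmaI finite_subset)
  then have "finite (ext_verts V E)" using E by (simp add: ext_verts_def)
  moreover have "ext_adj E y x" if "ext_adj E x y" for x y
    using E(3) that by (cases x; cases y) (auto dest: symD)
  moreover have "\<not> ext_adj E x x" for x
    using E(4) by (cases x) (auto simp: irrefl_def)
  ultimately show ?thesis by (auto simp: simple_rel_def ext_edges_def sym_def irrefl_def)
qed

text \<open>
  An independent set that meets the block of an edge \<open>uv\<close> avoids all other blocks and all vertices
  of the given graph except \<open>u\<close> and \<open>v\<close>, of which it contains at most one.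
\<close>

lemma card_independent_ext_le:
  assumes VE: "simple_rel V E" and I: "I \<subseteq> ext_verts V E" "ext_edges V E \<inter> I \<times> I = {}"
  shows "card I \<le> card V"
proof -
  have E: "finite V" "E \<subseteq> V \<times> V" using VE by (auto simp: simple_rel_def)
  have ind: "\<not> ext_adj E x y" if "x \<in> I" "y \<in> I" for x y
    using I that by (auto simp: ext_edges_def)
  show ?thesis
  proof (cases "\<exists>e i. Inr (e, i) \<in> I")
    case False
    then have "I \<subseteq> Inl ` V" using I(1) by (auto simp: ext_verts_def)
    then show ?thesis using E(1) by (metis card_image_le card_mono finite_imageI le_trans)
  next
    case True
    then obtain e i where ei: "Inr (e, i) \<in> I" by blast
    then obtain u v where uv: "(u, v) \<in> E" "e = {u, v}" using I(1) by (auto simp: ext_verts_def)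
    let ?B = "Inr ` ({e} \<times> {..<card V - 1}) :: ('a + 'a set \<times> nat) set"
    have old: "w \<in> e" if "Inl w \<in> I" for w using ind[OF that ei] by simp
    have new: "x \<in> Inr ` ({e} \<times> {..<card V - 1})" if x: "x \<in> I" "x = Inr (f, j)" for x f j
    proof -
      have "f = e" using ind[OF x(1) ei] x(2) by simp
      moreover have "j < card V - 1" using I(1) x by (auto simp: ext_verts_def)
      ultimately show ?thesis using x(2) by auto
    qed
    have "\<not> (Inl u \<in> I \<and> Inl v \<in> I)" using ind uv(1) by fastforce
    then obtain w where w: "\<And>x. Inl x \<in> I \<Longrightarrow> x = w" using old uv(2) by blast
    have "x \<in> insert (Inl w) ?B" if "x \<in> I" for x
    proof (cases x)
      case (Inl y)
      then show ?thesis using w that by simp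
    next
      case (Inr p)
      then show ?thesis using new[OF that, of "fst p" "snd p"] by simp
    qed
    then have "I \<subseteq> insert (Inl w) ?B" by blast
    then have "card I \<le> card (insert (Inl w) ?B)" by (intro card_mono) auto
    also have "\<dots> \<le> Suc (card ?B)" by (simp add: card_insert_if)
    also have "card ?B = card V - 1" by (simp add: card_image card_cartesian_product)
    also have "Suc (card V - 1) = card V"
    proof -
      have "0 < card V" using E uv(1) by (auto simp: card_gt_0_iff)
      then show ?thesis by simp
    qed
    finally show ?thesis .
  qed
qed

text \<open>
  The block of \<open>uv\<close> with \<open>u\<close> and \<open>v\<close>: deleting the edge \<open>uv\<close> raises the independence number.
\<close>

lemma ext_near_independent:
  assumes VE: "simple_rel V E" and uv: "(u, v) \<in> E"
  shows "\<exists>I \<subseteq> ext_verts V E. card I = Suc (card V) \<and>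
           ext_edges V E \<inter> I \<times> I \<subseteq> {(Inl u, Inl v), (Inl v, Inl u)}"
proof -
  have E: "finite V" "E \<subseteq> V \<times> V" "irrefl E" using VE by (auto simp: simple_rel_def)
  then have V: "u \<in> V" "v \<in> V" "u \<noteq> v" using uv by (auto simp: irrefl_def)
  let ?B = "Inr ` ({{u, v}} \<times> {..<card V - 1}) :: ('a + 'a set \<times> nat) set"
  let ?I = "{Inl u, Inl v} \<union> ?B"
  have "card ?B = card V - 1" by (simp add: card_image card_cartesian_product)
  moreover have "card {Inl u, Inl v :: 'a + 'a set \<times> nat} = 2" using V(3) by simp
  moreover have "card ?I = card {Inl u, Inl v :: 'a + 'a set \<times> nat} + card ?B"
    by (intro card_Un_disjoint) auto
  moreover have "0 < card V" using V E(1) by (auto simp: card_gt_0_iff)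
  ultimately have "card ?I = Suc (card V)" by linarith
  moreover have "?I \<subseteq> ext_verts V E"
    using V uv by (auto simp: ext_verts_def intro!: image_eqI[of _ _ "(u, v)"])
  moreover have "ext_edges V E \<inter> ?I \<times> ?I \<subseteq> {(Inl u, Inl v), (Inl v, Inl u)}"
    using E(3) by (auto simp: ext_edges_def irrefl_def)
  ultimately show ?thesis by blast
qed

text \<open>
  Without edges the whole vertex set is independent; otherwise drop an end of the edge from the set
  of the preceding lemma.
\<close>

lemma ex_independent_ext_card:
  assumes VE: "simple_rel V E"
  shows "\<exists>I \<subseteq> ext_verts V E. card I = card V \<and> ext_edges V E \<inter> I \<times> I = {}"
proof (cases "E = {}")
  case True
  then show ?thesis
    by (intro exI[of _ "Inl ` V"]) (auto simp: ext_verts_def ext_edges_def card_image)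
next
  case False
  then obtain u v where uv: "(u, v) \<in> E" by auto
  then have "u \<noteq> v" using VE by (auto simp: simple_rel_def irrefl_def)
  obtain I where I: "I \<subseteq> ext_verts V E" "card I = Suc (card V)"
      "ext_edges V E \<inter> I \<times> I \<subseteq> {(Inl u, Inl v), (Inl v, Inl u)}"
    using ext_near_independent[OF VE uv] by blast
  show ?thesis
  proof (cases "Inl v \<in> I")
    case True
    with I show ?thesis by (intro exI[of _ "I - {Inl v}"]) auto
  next
    case False
    obtain x where "x \<in> I" using I(2) by fastforce
    with I False show ?thesis by (intro exI[of _ "I - {x}"]) auto
  qed
qed

section \<open>From independence to toughness\<close>

text \<open>
  \<open>Leaf v j\<close> is a pendant vertex at \<open>Core v\<close> (apart from its edges to the hubs), \<open>Iso j\<close> is adjacent to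
  the hubs only, and a hub is adjacent to every other vertex.
\<close>

datatype 'c host_vertex = Core 'c | Leaf 'c nat | Iso nat | Hub nat

text \<open>
  By the choice of \<open>m\<close>, cutting a core vertex pays for itself through its leaves, but brings less
  than keeping it as a component of its own. The last assumption balances the canonical cutset, which
  consists of the hubs and the complement of a maximum independent set: its size is the left-hand
  side, and the number of components that it leaves is the factor after \<open>t\<close>.
\<close>

locale tough_host =
  fixes V :: "'c set" and N :: "('c \<times> 'c) set" and \<alpha> :: nat
    and t :: real and m k q :: nat
  assumes simple: "simple_rel V N"
    and independent_le: "I \<subseteq> V \<Longrightarrow> N \<inter> I \<times> I = {} \<Longrightarrow> card I \<le> \<alpha>"
    and ex_independent: "\<exists>I \<subseteq> V. card I = \<alpha> \<and> N \<inter> I \<times> I = {}"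
    and t_pos: "0 < t"
    and leaves_ge: "1 \<le> t * m" and leaves_less: "t * m < 1 + t"
    and isolated_ge: "2 \<le> k"
    and hubs: "real (q + (card V - \<alpha>)) = t * real (\<alpha> + m * (card V - \<alpha>) + k)"
begin

definition verts_host :: "'c host_vertex set" where
  "verts_host = Core ` V \<union> case_prod Leaf ` (V \<times> {..<m}) \<union> Iso ` {..<k} \<union> Hub ` {..<q}"

definition adj_host :: "'c host_vertex \<Rightarrow> 'c host_vertex \<Rightarrow> bool" where
  "adj_host x y \<longleftrightarrow> x \<noteq> y \<and>
     ((\<exists>j. x = Hub j \<or> y = Hub j) \<or>
      (\<exists>u v. x = Core u \<and> y = Core v \<and> (u, v) \<in> N) \<or>
      (\<exists>v j. x = Core v \<and> y = Leaf v j \<or> x = Leaf v j \<and> y = Core v))"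

definition edges_host :: "('c host_vertex \<times> 'c host_vertex) set" where
  "edges_host = {(x, y) \<in> verts_host \<times> verts_host. adj_host x y}"

lemma finite_V: "finite V" and sym_N: "sym N" and irrefl_N: "irrefl N"
  using simple by (auto simp: simple_rel_def)

lemma alpha_le: "\<alpha> \<le> card V"
  using ex_independent finite_V card_mono by blast

lemma finite_verts_host: "finite verts_host"
  using finite_V by (simp add: verts_host_def)

lemma simple_rel_host: "simple_rel verts_host edges_host"
  using finite_verts_host sym_N
  by (auto simp: simple_rel_def edges_host_def adj_host_def sym_def irrefl_def)

lemma core_edge_iff: "u \<in> V \<Longrightarrow> v \<in> V \<Longrightarrow> (Core u, Core v) \<in> edges_host \<longleftrightarrow> (u, v) \<in> N"
  using irrefl_N by (auto simp: edges_host_def verts_host_def adj_host_def irrefl_def)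

text \<open>
  Let \<open>T\<close> be the part of the cutset in the core, \<open>R\<close> the rest of the core, and \<open>r\<close> the number of colours
  on \<open>R\<close>. A leaf has a colour of its own only if its neighbour is in \<open>T\<close>, which bounds the number of colours by
  \<open>r + card T * m + k\<close>. One vertex of \<open>R\<close> for each colour gives an independent set, whence
  \<open>r \<le> \<alpha>\<close>; the rest is arithmetic.
\<close>

lemma tough_on_host: "tough_on t verts_host edges_host"
  unfolding tough_on_def
proof (intro allI impI)
  fix S and c :: "'c host_vertex \<Rightarrow> nat"
  assume S: "S \<subseteq> verts_host" and c: "component_colouring edges_host S c"
    and two: "2 \<le> card (c ` (verts_host - S))"
  have c_eq: "c x = c y"
    if "x \<in> verts_host" "y \<in> verts_host" "x \<notin> S" "y \<notin> S" "adj_host x y" for x y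
    using that c by (auto simp: component_colouring_def edges_host_def)
  have hub: "Hub j \<in> S" if "j < q" for j
  proof (rule ccontr)
    assume j: "Hub j \<notin> S"
    have "Hub j \<in> verts_host" using that by (simp add: verts_host_def)
    then have "c x = c (Hub j)" if "x \<in> verts_host - S" for x
      using that j by (cases "x = Hub j") (auto intro!: c_eq simp: adj_host_def)
    then have "c ` (verts_host - S) \<subseteq> {c (Hub j)}" by blast
    then have "card (c ` (verts_host - S)) \<le> card {c (Hub j)}" by (intro card_mono) auto
    then show False using two by simp
  qed
  define T where "T = {v \<in> V. Core v \<in> S}"
  define R where "R = V - T"
  define r where "r = card ((c \<circ> Core) ` R)"
  have fin: "finite T" "finite R" using finite_V by (auto simp: T_def R_def)
  have "c x \<in> (c \<circ> Core) ` R \<union> c ` case_prod Leaf ` (T \<times> {..<m}) \<union> c ` Iso ` {..<k}"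
    if x: "x \<in> verts_host" "x \<notin> S" for x
  proof (cases x)
    case (Core v)
    then show ?thesis using x by (auto simp: verts_host_def R_def T_def)
  next
    case (Leaf v j)
    then have vj: "v \<in> V" "j < m" using x(1) by (auto simp: verts_host_def)
    show ?thesis
    proof (cases "v \<in> T")
      case True
      then show ?thesis using Leaf vj by force
    next
      case False
      then have "c x = c (Core v)" "v \<in> R"
        using x vj Leaf by (auto intro!: c_eq simp: T_def R_def adj_host_def verts_host_def)
      then show ?thesis by auto
    qed
  next
    case (Iso j)
    then show ?thesis using x by (auto simp: verts_host_def)
  next
    case (Hub j)
    then show ?thesis using x hub by (auto simp: verts_host_def)
  qed
  then have "card (c ` (verts_host - S))
      \<le> card ((c \<circ> Core) ` R \<union> c ` case_prod Leaf ` (T \<times> {..<m}) \<union> c ` Iso ` {..<k})"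
    using fin by (intro card_mono) auto
  also have "\<dots> \<le> r + card (c ` case_prod Leaf ` (T \<times> {..<m})) + card (c ` Iso ` {..<k})"
    unfolding r_def by (meson add_le_mono card_Un_le le_refl le_trans)
  also have "card (c ` case_prod Leaf ` (T \<times> {..<m})) \<le> card T * m"
    unfolding image_image using card_image_le[of "T \<times> {..<m}"] fin
    by (simp add: card_cartesian_product)
  also have "card (c ` Iso ` {..<k}) \<le> k"
    unfolding image_image using card_image_le[of "{..<k}"] by simp
  finally have colours: "card (c ` (verts_host - S)) \<le> r + card T * m + k" by simp
  have "r \<le> \<alpha>"
  proof -
    obtain A where A: "A \<subseteq> R" "inj_on (c \<circ> Core) A" "(c \<circ> Core) ` R = (c \<circ> Core) ` A"
      using subset_image_inj[of "(c \<circ> Core) ` R" "c \<circ> Core" R] by blast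
    have "(u, v) \<notin> N" if "u \<in> A" "v \<in> A" for u v
    proof
      assume uv: "(u, v) \<in> N"
      then have "u \<noteq> v" using irrefl_N by (auto simp: irrefl_def)
      moreover have "c (Core u) = c (Core v)"
        using uv that A(1) \<open>u \<noteq> v\<close>
        by (intro c_eq) (auto simp: R_def T_def adj_host_def verts_host_def)
      ultimately show False using A(2) that by (simp add: inj_on_def)
    qed
    then have "card A \<le> \<alpha>" using A(1) by (intro independent_le) (auto simp: R_def)
    then show ?thesis unfolding r_def A(3) using A(2) by (simp add: card_image del: o_apply)
  qed
  have "r \<le> card R" unfolding r_def using fin by (intro card_image_le)
  moreover have "card R + card T = card V"
    using card_Diff_subset[of T V] card_mono[of V T] finite_V fin(1)
    by (auto simp: R_def T_def)
  ultimately have rT: "real r + card T \<le> card V" by linarith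
  have "card (Hub ` {..<q} \<union> Core ` T) \<le> card S"
    using S hub finite_verts_host finite_subset by (intro card_mono) (auto simp: T_def)
  moreover have "card (Hub ` {..<q} \<union> Core ` T) = q + card T"
    using fin by (subst card_Un_disjoint) (auto simp: card_image inj_on_def)
  ultimately have sizeS: "real q + card T \<le> card S" by linarith
  have "t * card (c ` (verts_host - S)) \<le> t * (r + card T * m + k)"
    using colours t_pos by (intro mult_left_mono) (auto simp flip: of_nat_mult of_nat_add)
  also have "\<dots> \<le> q + card T"
  proof -
    \<comment> \<open>The worst case is \<open>card T = card V - r\<close>, and among these cases \<open>r = \<alpha>\<close>.\<close>
    have "(t * m - 1) * card T \<le> (t * m - 1) * (card V - real r)"
      using rT leaves_ge by (intro mult_left_mono) auto
    moreover have "0 \<le> (1 + t - t * m) * (\<alpha> - real r)"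
      using leaves_less \<open>r \<le> \<alpha>\<close> by simp
    moreover have "q + (card V - real \<alpha>) = t * (\<alpha> + m * (card V - real \<alpha>) + k)"
      using hubs alpha_le by (simp add: of_nat_diff)
    ultimately show ?thesis by (simp add: algebra_simps)
  qed
  finally show "t * card (c ` (verts_host - S)) \<le> card S" using sizeS by linarith
qed

text \<open>
  The edge set \<open>M\<close> is variable because this cutset is needed twice: for the minimal spanning
  subgraph, where it bounds the toughness from above, and for the host without a core edge, where
  a larger \<open>I\<close> becomes independent.
\<close>

lemma ex_cut_of_independent:
  assumes I: "I \<subseteq> V" and M: "M \<subseteq> edges_host" "M \<inter> Core ` I \<times> Core ` I = {}"
  shows "\<exists>S (c :: 'c host_vertex \<Rightarrow> 'c host_vertex). S \<subseteq> verts_host \<and>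
           component_colouring M S c \<and>
           card (c ` (verts_host - S)) = card I + m * (card V - card I) + k \<and>
           card S = q + (card V - card I)"
proof -
  define S :: "'c host_vertex set" where "S = Hub ` {..<q} \<union> Core ` (V - I)"
  \<comment> \<open>The remaining components are single vertices, except that a kept core vertex absorbs its leaves.\<close>
  define c :: "'c host_vertex \<Rightarrow> 'c host_vertex"
    where "c x = (case x of Leaf v j \<Rightarrow> if v \<in> I then Core v else x | _ \<Rightarrow> x)" for x
  have fin: "finite I" using I finite_V finite_subset by blast
  define L :: "'c host_vertex set" where "L = case_prod Leaf ` ((V - I) \<times> {..<m})"
  have "c ` (verts_host - S) = Core ` I \<union> L \<union> Iso ` {..<k}"
  proof
    show "c ` (verts_host - S) \<subseteq> Core ` I \<union> L \<union> Iso ` {..<k}"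
      by (force simp: verts_host_def S_def L_def c_def split: if_splits)
    have "x \<in> verts_host - S" "c x = x" if "x \<in> Core ` I \<union> L \<union> Iso ` {..<k}" for x
      using that I by (auto simp: verts_host_def S_def L_def c_def)
    then show "Core ` I \<union> L \<union> Iso ` {..<k} \<subseteq> c ` (verts_host - S)"
      by (metis (no_types, lifting) imageI subsetI)
  qed
  also have "card \<dots> = card (Core ` I :: 'c host_vertex set) + card L
      + card (Iso ` {..<k} :: 'c host_vertex set)"
  proof -
    have "finite L" using finite_V by (simp add: L_def)
    moreover have "Core ` I \<inter> L = {}" "(Core ` I \<union> L) \<inter> Iso ` {..<k} = {}"
      by (auto simp: L_def)
    ultimately show ?thesis using fin by (simp add: card_Un_disjoint)
  qed
  also have "card L = m * (card V - card I)"
  proof -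
    have "inj_on (case_prod Leaf) ((V - I) \<times> {..<m})" by (auto simp: inj_on_def)
    then show ?thesis
      using I fin by (simp add: L_def card_image card_cartesian_product card_Diff_subset)
  qed
  also have "card (Core ` I :: 'c host_vertex set) = card I"
    by (intro card_image) (simp add: inj_on_def)
  also have "card (Iso ` {..<k} :: 'c host_vertex set) = k"
    by (subst card_image) (simp_all add: inj_on_def)
  finally have "card (c ` (verts_host - S)) = card I + m * (card V - card I) + k" .
  moreover have "card S = q + (card V - card I)"
    unfolding S_def using I fin finite_V
    by (subst card_Un_disjoint) (auto simp: card_image inj_on_def card_Diff_subset)
  moreover have "S \<subseteq> verts_host" by (auto simp: S_def verts_host_def)
  moreover have "component_colouring M S c"
    unfolding component_colouring_def
  proof (intro allI impI)
    fix x y assume xy: "(x, y) \<in> M" "x \<notin> S" "y \<notin> S"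
    have "x \<in> verts_host" "y \<in> verts_host" "adj_host x y"
      using xy(1) M(1) by (auto simp: edges_host_def)
    have no_hub: "x \<noteq> Hub j \<and> y \<noteq> Hub j" for j
      using \<open>x \<in> verts_host\<close> \<open>y \<in> verts_host\<close> xy(2,3) by (auto simp: verts_host_def S_def)
    have core: "v \<in> I" if "x = Core v \<or> y = Core v" for v
      using that \<open>x \<in> verts_host\<close> \<open>y \<in> verts_host\<close> xy(2,3) by (auto simp: verts_host_def S_def)
    have "\<not> (x = Core u \<and> y = Core v)" for u v
      using core xy(1) M(2) by blast
    then consider v j where "x = Core v" "y = Leaf v j" | v j where "x = Leaf v j" "y = Core v"
      using \<open>adj_host x y\<close> no_hub unfolding adj_host_def by blast
    then show "c x = c y" using core by cases (auto simp: c_def)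
  qed
  ultimately show ?thesis by blast
qed

text \<open>
  Compared with the balanced cutset, keeping one more core vertex saves one vertex of the cutset
  and changes the number of components by \<open>1 - m\<close>. Since \<open>t * (1 - m) > -1\<close>, the cutset is now too
  small for its components.
\<close>

lemma not_tough_on_host_del_edge:
  assumes I: "I \<subseteq> V" "card I = Suc \<alpha>" "N \<inter> I \<times> I \<subseteq> {(u, v), (v, u)}"
  shows "\<not> tough_on t verts_host (edges_host - {(Core u, Core v), (Core v, Core u)})"
    (is "\<not> tough_on t verts_host ?M")
proof
  assume tough: "tough_on t verts_host ?M"
  have "?M \<inter> Core ` I \<times> Core ` I = {}"
    using I(3) by (auto simp: edges_host_def adj_host_def)
  then obtain S and c :: "'c host_vertex \<Rightarrow> 'c host_vertex"
    where S: "S \<subseteq> verts_host" "component_colouring ?M S c"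
      "card (c ` (verts_host - S)) = Suc \<alpha> + m * (card V - Suc \<alpha>) + k"
      "card S = q + (card V - Suc \<alpha>)"
    using ex_cut_of_independent[OF I(1)] I(2) by (metis Diff_subset)
  have less: "Suc \<alpha> \<le> card V" using I finite_V card_mono by metis
  have "t * card (c ` (verts_host - S)) \<le> card S"
    using S isolated_ge by (intro tough_onD[OF tough finite_verts_host]) auto
  moreover obtain d where d: "card V = Suc \<alpha> + d" using less le_Suc_ex by blast
  ultimately have "t * real (Suc \<alpha> + m * d + k) \<le> real (q + d)" using S(3,4) by simp
  moreover have "real (q + Suc d) = t * real (\<alpha> + m * Suc d + k)" using hubs d by simp
  ultimately show False using leaves_less by (simp add: algebra_simps)
qed

end

text \<open>
  Write \<open>t = a / b\<close> and let the balanced cutset leave \<open>b * x\<close> components, so that it has to have \<open>a * x\<close>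
  vertices. Any large \<open>x\<close> leaves room for \<open>k\<close> isolated vertices and \<open>q\<close> hubs.
\<close>

lemma ex_host_parameters:
  fixes t :: real and \<alpha> n :: nat
  assumes "t \<in> \<rat>" "0 < t" "\<alpha> \<le> n"
  shows "\<exists>m k q :: nat. 1 \<le> t * m \<and> t * m < 1 + t \<and> 2 \<le> k \<and>
           real (q + (n - \<alpha>)) = t * real (\<alpha> + m * (n - \<alpha>) + k)"
proof -
  obtain a b :: nat where ab: "b \<noteq> 0" "\<bar>t\<bar> = a / b" using assms(1) by (elim Rats_abs_nat_div_natE)
  then have t: "t = a / b" using assms(2) by simp
  then have "0 < a" "0 < b" using ab assms(2) by (auto intro!: gr0I)
  define m where "m = nat \<lceil>1 / t\<rceil>"
  have "0 < 1 / t" using assms(2) by simp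
  then have "0 \<le> \<lceil>1 / t\<rceil>" unfolding zero_le_ceiling by linarith
  then have "real m = of_int \<lceil>1 / t\<rceil>" by (simp add: m_def)
  then have "1 / t \<le> m" "m < 1 / t + 1" using ceiling_correct[of "1 / t"] by linarith+
  then have m: "1 \<le> t * m" "t * m < 1 + t" using assms(2) by (auto simp: field_simps)
  define x where "x = n + m * n + 2"
  define k where "k = b * x - (\<alpha> + m * (n - \<alpha>))"
  define q where "q = a * x - (n - \<alpha>)"
  have "\<alpha> + m * (n - \<alpha>) + 2 \<le> x"
    unfolding x_def using assms(3) by (intro add_mono mult_mono) auto
  also have "x \<le> b * x" using \<open>0 < b\<close> by simp
  finally have k: "2 \<le> k" "\<alpha> + m * (n - \<alpha>) + k = b * x" by (auto simp: k_def)
  have "n - \<alpha> \<le> x" by (simp add: x_def)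
  also have "x \<le> a * x" using \<open>0 < a\<close> by simp
  finally have "q + (n - \<alpha>) = a * x" by (simp add: q_def)
  moreover have "t * real (b * x) = real (a * x)" using t ab by simp
  ultimately have "real (q + (n - \<alpha>)) = t * real (\<alpha> + m * (n - \<alpha>) + k)"
    by (simp only: k(2))
  then show ?thesis using m k(1) by blast
qed

section \<open>Embedding an arbitrary graph\<close>

lemma ex_minimally_tough_rel:
  fixes V :: "'a set"
  assumes t: "t \<in> \<rat>" "0 < t" and VE: "simple_rel V E"
  shows "\<exists>(W :: nat set) M g. simple_rel W M \<and> minimally_tough t (rel_graph W M) \<and>
           inj_on g V \<and> g ` V \<subseteq> W \<and> (\<forall>u\<in>V. \<forall>v\<in>V. (g u, g v) \<in> M \<longleftrightarrow> (u, v) \<in> E)"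
proof -
  let ?P = "ext_verts V E" and ?N = "ext_edges V E" and ?\<alpha> = "card V"
  have fin: "finite ?P" using simple_rel_ext[OF VE] by (simp add: simple_rel_def)
  obtain I where I: "I \<subseteq> ?P" "card I = ?\<alpha>" "?N \<inter> I \<times> I = {}"
    using ex_independent_ext_card[OF VE] by blast
  then have le: "?\<alpha> \<le> card ?P" using fin card_mono by metis
  obtain m k q :: nat where par: "1 \<le> t * m" "t * m < 1 + t" "2 \<le> k"
      "real (q + (card ?P - ?\<alpha>)) = t * real (?\<alpha> + m * (card ?P - ?\<alpha>) + k)"
    using ex_host_parameters[OF t le] by blast
  interpret tough_host ?P ?N ?\<alpha> t m k q
    using simple_rel_ext[OF VE] card_independent_ext_le[OF VE] ex_independent_ext_card[OF VE] t(2) par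
    by unfold_locales auto
  let ?core = "\<lambda>v. Core (Inl v) :: ('a + 'a set \<times> nat) host_vertex"
  define F where "F = {(?core u, ?core v) | u v. (u, v) \<in> E}"
  have "\<not> tough_on t verts_host (edges_host - {(x, y), (y, x)})" if xy: "(x, y) \<in> F" for x y
  proof -
    obtain u v where "(u, v) \<in> E" "x = ?core u" "y = ?core v" using xy by (auto simp: F_def)
    moreover from this obtain J where "J \<subseteq> ?P" "card J = Suc ?\<alpha>"
        "?N \<inter> J \<times> J \<subseteq> {(Inl u, Inl v), (Inl v, Inl u)}"
      using ext_near_independent[OF VE] by blast
    ultimately show ?thesis using not_tough_on_host_del_edge by simp
  qed
  then obtain M where M: "M \<subseteq> edges_host" "simple_rel verts_host M" "tough_on t verts_host M"
      "F \<inter> edges_host \<subseteq> M"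
      "\<And>x y. (x, y) \<in> M \<Longrightarrow> \<not> tough_on t verts_host (M - {(x, y), (y, x)})"
    using ex_minimal_tough_spanning[OF simple_rel_host tough_on_host] by blast
  have inV: "Inl v \<in> ?P" if "v \<in> V" for v using that by (simp add: ext_verts_def)
  have core_iff: "(?core u, ?core v) \<in> M \<longleftrightarrow> (u, v) \<in> E" if "u \<in> V" "v \<in> V" for u v
  proof -
    have "(?core u, ?core v) \<in> edges_host \<longleftrightarrow> (u, v) \<in> E"
      using that inV by (simp add: core_edge_iff) (simp add: ext_edges_def)
    then show ?thesis using M(1,4) by (auto simp: F_def)
  qed
  \<comment> \<open>The balanced cutset of the host keeps the toughness of its spanning subgraph from exceeding \<open>t\<close>.\<close>
  have "M \<inter> Core ` I \<times> Core ` I = {}"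
    using M(1) I(3) by (auto simp: edges_host_def adj_host_def)
  then obtain S and c :: "('a + 'a set \<times> nat) host_vertex \<Rightarrow> ('a + 'a set \<times> nat) host_vertex"
    where S: "S \<subseteq> verts_host" "component_colouring M S c"
      "card (c ` (verts_host - S)) = ?\<alpha> + m * (card ?P - ?\<alpha>) + k"
      "card S = q + (card ?P - ?\<alpha>)"
    using ex_cut_of_independent[OF I(1) M(1)] unfolding I(2) by blast
  obtain f :: "('a + 'a set \<times> nat) host_vertex \<Rightarrow> nat" where f: "inj_on f verts_host"
    using finite_imp_inj_to_nat_seg[OF finite_verts_host] by blast
  let ?W = "f ` verts_host" and ?M = "map_prod f f ` M"
  have M_sub: "M \<subseteq> verts_host \<times> verts_host" using M(2) by (simp add: simple_rel_def)
  have "minimally_tough t (rel_graph ?W ?M)"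
  proof (rule minimally_tough_image[OF f M(2) t(2) M(3,5) S(1,2)])
    show "2 \<le> card (c ` (verts_host - S))" using S(3) par(3) by simp
    show "t * card (c ` (verts_host - S)) = card S" unfolding S(3,4) using par(4) by simp
  qed
  moreover have core_sub: "?core ` V \<subseteq> verts_host" using inV by (auto simp: verts_host_def)
  moreover from this have "inj_on (f \<circ> ?core) V"
    using f by (intro comp_inj_on) (auto simp: inj_on_def)
  moreover have "((f \<circ> ?core) u, (f \<circ> ?core) v) \<in> ?M \<longleftrightarrow> (u, v) \<in> E" if "u \<in> V" "v \<in> V" for u v
  proof -
    have "?core u \<in> verts_host" "?core v \<in> verts_host" using that core_sub by auto
    then show ?thesis using map_prod_image_iff[OF f M_sub] core_iff[OF that] by simp
  qed
  moreover have "(f \<circ> ?core) ` V \<subseteq> ?W"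
    using core_sub by auto
  moreover have "simple_rel ?W ?M" using M(2) f by (rule simple_rel_image)
  ultimately show ?thesis
    by (intro exI[of _ ?W] exI[of _ ?M] exI[of _ "f \<circ> ?core"] conjI ballI)
qed

text \<open>
  A graph has no parallel arcs, so mapping each arc to the pair of images of its ends is injective.
\<close>

lemma digraph_iso_induced_rel_graph:
  assumes G: "graph G" and WM: "simple_rel W M"
    and g: "inj_on g (verts G)" "g ` verts G \<subseteq> W"
    and adj: "\<And>u v. u \<in> verts G \<Longrightarrow> v \<in> verts G \<Longrightarrow> (g u, g v) \<in> M \<longleftrightarrow> (u, v) \<in> arcs_ends G"
  shows "\<exists>K. induced_subgraph K (rel_graph W M) \<and> digraph_iso G K"
proof -
  interpret graph G by fact
  interpret H: graph "rel_graph W M" using WM by (rule graph_rel_graph)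
  let ?K = "rel_graph W M \<restriction> (g ` verts G)"
  let ?h = "\<lparr>iso_verts = g, iso_arcs = \<lambda>e. (g (tail G e), g (head G e)), iso_head = snd, iso_tail = fst\<rparr>"
  have "inj_on (\<lambda>e. (g (tail G e), g (head G e))) (arcs G)"
  proof (rule inj_onI)
    fix d e assume "d \<in> arcs G" "e \<in> arcs G"
      "(g (tail G d), g (head G d)) = (g (tail G e), g (head G e))"
    then show "d = e"
      using g(1) by (intro no_multi_arcs) (auto simp: arc_to_ends_def dest: inj_onD)
  qed
  then have "digraph_isomorphism ?h"
    using g(1) wf_digraph by (auto simp: digraph_isomorphism_def)
  moreover have "?K = app_iso ?h G"
  proof -
    have "arcs ?K = (\<lambda>e. (g (tail G e), g (head G e))) ` arcs G"
    proof (intro equalityI subsetI)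
      fix p assume p: "p \<in> arcs ?K"
      then obtain u v where uv: "u \<in> verts G" "v \<in> verts G" "p = (g u, g v)"
        by (cases p) auto
      then have "(u, v) \<in> arcs_ends G" using p adj by simp
      then obtain e where "e \<in> arcs G" "u = tail G e" "v = head G e"
        by (auto simp: arcs_ends_def arc_to_ends_def)
      then show "p \<in> (\<lambda>e. (g (tail G e), g (head G e))) ` arcs G" using uv(3) by blast
    next
      fix p assume "p \<in> (\<lambda>e. (g (tail G e), g (head G e))) ` arcs G"
      then obtain e where e: "e \<in> arcs G" "p = (g (tail G e), g (head G e))" by blast
      then have "(tail G e, head G e) \<in> arcs_ends G"
        by (auto simp: arcs_ends_def arc_to_ends_def)
      then show "p \<in> arcs ?K" using e adj by simp
    qed
    then show ?thesis
      by (intro pre_digraph.equality) (auto simp: app_iso_def)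
  qed
  moreover have "induced_subgraph ?K (rel_graph W M)"
    using g(2) by (intro H.induced_induce) simp
  ultimately show ?thesis unfolding digraph_iso_def by blast
qed

theorem theorem1p10:
  fixes t :: real and G :: "('a, 'b) pre_digraph"
  assumes "t \<in> \<rat>" and "t > 0" and "graph G"
  shows "\<exists>H :: (nat, nat \<times> nat) pre_digraph.
           graph H \<and> minimally_tough t H \<and>
           (\<exists>K. induced_subgraph K H \<and> digraph_iso G K)"
proof -
  interpret graph G by fact
  have simple: "simple_rel (verts G) (arcs_ends G)"
    unfolding simple_rel_def
  proof (intro conjI)
    show "sym (arcs_ends G)" using sym_arcs by (simp add: symmetric_def)
    show "arcs_ends G \<subseteq> verts G \<times> verts G" "irrefl (arcs_ends G)"
      using no_loops by (auto simp: irrefl_def arcs_ends_def arc_to_ends_def)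
  qed simp
  obtain W :: "nat set" and M g where WM: "simple_rel W M"
      and min: "minimally_tough t (rel_graph W M)"
      and g: "inj_on g (verts G)" "g ` verts G \<subseteq> W"
        "\<forall>u\<in>verts G. \<forall>v\<in>verts G. (g u, g v) \<in> M \<longleftrightarrow> (u, v) \<in> arcs_ends G"
    using ex_minimally_tough_rel[OF assms(1,2) simple] by (elim exE conjE)
  have "\<exists>K. induced_subgraph K (rel_graph W M) \<and> digraph_iso G K"
    using g(3) by (intro digraph_iso_induced_rel_graph[OF assms(3) WM g(1,2)]) simp
  then show ?thesis using min graph_rel_graph[OF WM] by blast
qed

end
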